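(* Let $(\mathcal M,f,\mu,X,h,x_0)$ be as in the context, and set $F:=h\circ f\circ(h|_X)^{-1}:h(X)\to h(X)$. Then there is a family $(Q_\delta)_{\delta>0}$ of Markov transition functions on $\mathbb R^d$ such that $F$ is the zero-noise limit of $(Q_\delta)_{\delta>0}$ as $\delta\to0^+$ and, for every $\delta>0$, the support of any stationary probability measure of $Q_\delta$ is within Hausdorff distance $\delta$ of $h(X)$, the image under $h$ of the support of $\mu$.
   Context: $\mathcal M$ is a manifold, $f:\mathcal M\to\mathcal M$ is continuous, $\mu$ is an $f$-invariant ergodic Borel probability measure whose support $X$ is compact. $h:\mathcal M\to\mathbb R^d$ is a continuous injective map. $x_0\in\mathcal M$ is a point in the basin of $\mu$, i.e. $\frac1N\sum_{n=0}^{N-1}\delta_{f^nx_0}\to\mu$ weakly as $N\to\infty$ ($\delta_a$ is the Dirac measure at $a$). A Markov transition function on $\mathbb R^d$ is a measurable map $Q$ from $\mathbb R^d$ to Borel probability measures on $\mathbb R^d$; a probability measure $\alpha$ is stationary for $Q$ if $\int Q(x)(A)\,d\alpha(x)=\alpha(A)$ for all Borel $A$. $F$ is the zero-noise limit of $(Q_\delta)_{\delta>0}$ if for every $x\in h(X)$ the measures $Q_\delta(x)$ converge weakly to $\delta_{F(x)}$ as $\delta\to0^+$. *)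

theory Defs
  imports "HOL-Probability.Probability"
begin

definition topological_manifold :: "nat \<Rightarrow> 'a topology \<Rightarrow> bool" where
  "topological_manifold n X \<longleftrightarrow>
     Hausdorff_space X \<and> second_countable X \<and>
     (\<forall>x\<in>topspace X. \<exists>U V. openin X U \<and> x \<in> U \<and> openin (Euclidean_space n) V \<and>
        subtopology X U homeomorphic_space subtopology (Euclidean_space n) V)"

definition measure_support :: "'a::topological_space measure \<Rightarrow> 'a set" where
  "measure_support \<mu> = {x. \<forall>U. open U \<longrightarrow> x \<in> U \<longrightarrow> emeasure \<mu> U \<noteq> 0}"

definition borel_prob_measure :: "'a::topological_space measure \<Rightarrow> bool" where
  "borel_prob_measure \<mu> \<longleftrightarrow> prob_space \<mu> \<and> sets \<mu> = sets borel"

definition invariant_measure :: "('a::topological_space \<Rightarrow> 'a) \<Rightarrow> 'a measure \<Rightarrow> bool" where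
  "invariant_measure f \<mu> \<longleftrightarrow> (\<forall>A\<in>sets borel. emeasure \<mu> (f -` A) = emeasure \<mu> A)"

definition ergodic_measure :: "('a::topological_space \<Rightarrow> 'a) \<Rightarrow> 'a measure \<Rightarrow> bool" where
  "ergodic_measure f \<mu> \<longleftrightarrow>
     invariant_measure f \<mu> \<and>
     (\<forall>A\<in>sets borel. f -` A = A \<longrightarrow> emeasure \<mu> A = 0 \<or> emeasure \<mu> A = 1)"

definition weak_limit :: "('i \<Rightarrow> 'a::topological_space measure) \<Rightarrow> 'a measure \<Rightarrow> 'i filter \<Rightarrow> bool" where
  "weak_limit \<nu> \<mu> Net \<longleftrightarrow>
     (\<forall>\<phi>::'a \<Rightarrow> real. continuous_on UNIV \<phi> \<longrightarrow> bounded (range \<phi>) \<longrightarrow>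
        ((\<lambda>i. integral\<^sup>L (\<nu> i) \<phi>) \<longlongrightarrow> integral\<^sup>L \<mu> \<phi>) Net)"

text \<open>The average of the Dirac measures at the first \<open>N\<close> points of the orbit of \<open>x\<close>, written as
  the image of the uniform distribution on \<open>{0, ..., N - 1}\<close>; see \<open>emeasure_empirical_measure\<close>.\<close>
definition empirical_measure :: "('a::topological_space \<Rightarrow> 'a) \<Rightarrow> 'a \<Rightarrow> nat \<Rightarrow> 'a measure" where
  "empirical_measure f x N = distr (uniform_count_measure {..<N}) borel (\<lambda>n. (f ^^ n) x)"

lemma emeasure_empirical_measure:
  assumes "N > 0" and A: "A \<in> sets borel"
  shows "emeasure (empirical_measure f x N) A =
           (\<Sum>n<N. emeasure (return borel ((f ^^ n) x)) A) / of_nat N"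
proof -
  have m: "(\<lambda>n. (f ^^ n) x) \<in> measurable (uniform_count_measure {..<N}) borel"
    by (simp add: uniform_count_measure_def)
  define B where "B = {n\<in>{..<N}. (f ^^ n) x \<in> A}"
  have "emeasure (empirical_measure f x N) A = emeasure (uniform_count_measure {..<N}) B"
    unfolding empirical_measure_def B_def
    by (subst emeasure_distr[OF m A]) (auto simp: space_uniform_count_measure intro!: arg_cong[where f="emeasure _"])
  also have "\<dots> = ennreal (card B / N)"
    by (subst emeasure_uniform_count_measure) (auto simp: B_def)
  also have "\<dots> = of_nat (card B) / of_nat N"
    using \<open>N > 0\<close> by (simp add: divide_ennreal[symmetric] ennreal_of_nat_eq_real_of_nat)
  also have "(of_nat (card B) :: ennreal) = (\<Sum>n<N. indicator A ((f ^^ n) x))"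
    by (simp add: B_def indicator_def sum.If_cases Int_def)
  also have "\<dots> = (\<Sum>n<N. emeasure (return borel ((f ^^ n) x)) A)"
    using A by simp
  finally show ?thesis .
qed

definition in_basin :: "('a::topological_space \<Rightarrow> 'a) \<Rightarrow> 'a measure \<Rightarrow> 'a \<Rightarrow> bool" where
  "in_basin f \<mu> x \<longleftrightarrow> weak_limit (empirical_measure f x) \<mu> sequentially"

definition markov_transition :: "('a::topological_space \<Rightarrow> 'a measure) \<Rightarrow> bool" where
  "markov_transition Q \<longleftrightarrow> Q \<in> measurable borel (prob_algebra borel)"

definition stationary :: "('a::topological_space \<Rightarrow> 'a measure) \<Rightarrow> 'a measure \<Rightarrow> bool" where
  "stationary Q \<alpha> \<longleftrightarrow>
     borel_prob_measure \<alpha> \<and>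
     (\<forall>A\<in>sets borel. (\<integral>\<^sup>+ x. emeasure (Q x) A \<partial>\<alpha>) = emeasure \<alpha> A)"

definition zero_noise_limit_on ::
  "'a::topological_space set \<Rightarrow> (real \<Rightarrow> 'a \<Rightarrow> 'a measure) \<Rightarrow> ('a \<Rightarrow> 'a) \<Rightarrow> bool" where
  "zero_noise_limit_on Y Q F \<longleftrightarrow>
     (\<forall>x\<in>Y. weak_limit (\<lambda>\<delta>. Q \<delta> x) (return borel (F x)) (at_right 0))"

text \<open>With values in \<^typ>\<open>ennreal\<close>, unbounded or empty sets get distance \<open>\<infinity>\<close> instead of an
  arbitrary real value (two empty sets have distance \<open>0\<close>).\<close>
definition hausdorff_distance :: "'a::metric_space set \<Rightarrow> 'a set \<Rightarrow> ennreal" where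
  "hausdorff_distance A B =
     max (SUP a\<in>A. INF b\<in>B. ennreal (dist a b)) (SUP b\<in>B. INF a\<in>A. ennreal (dist a b))"

definition conjugate_map :: "('a \<Rightarrow> 'b) \<Rightarrow> ('a \<Rightarrow> 'a) \<Rightarrow> 'a set \<Rightarrow> 'b \<Rightarrow> 'b" where
  "conjugate_map h f X = h \<circ> f \<circ> inv_into X h"

text \<open>The support is forward invariant, so the conjugated map is a self-map of its image.\<close>
lemma conjugate_map_support_into:
  fixes f :: "'a::topological_space \<Rightarrow> 'a"
  assumes f: "continuous_on UNIV f" and inv: "invariant_measure f \<mu>"
  shows "conjugate_map h f (measure_support \<mu>) \<in> h ` measure_support \<mu> \<rightarrow> h ` measure_support \<mu>"
proof -
  have fX: "f x \<in> measure_support \<mu>" if x: "x \<in> measure_support \<mu>" for x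
    unfolding measure_support_def
  proof safe
    fix U assume U: "open U" "f x \<in> U" and 0: "emeasure \<mu> U = 0"
    have "open (f -` U)"
      using f U(1) by (simp add: continuous_on_open_vimage)
    with x U(2) have "emeasure \<mu> (f -` U) \<noteq> 0"
      by (auto simp: measure_support_def)
    with 0 inv U(1) show False
      by (simp add: invariant_measure_def)
  qed
  show ?thesis
    using fX inv_into_into[of _ h "measure_support \<mu>"] by (auto simp: conjugate_map_def)
qed

end

theory Submission
  imports Defs
begin

text \<open>
  The transition functions are free to be chosen, and the invariant measure itself supplies a
  convenient noise. Put \<open>K = h ` X\<close> and \<open>\<nu> = distr \<mu> borel h\<close>. Then \<open>K\<close> is compact, \<open>\<nu>\<close> gives no mass
  to the complement of \<open>K\<close>, and \<open>\<nu>\<close> charges every open set that meets \<open>K\<close>.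
  From a point \<open>x\<close> of \<open>K\<close>, let the chain resample its position from \<open>\<nu>\<close> with probability
  \<open>p = min \<delta> 1\<close>, and let it move to \<open>F x\<close> otherwise; from a point outside \<open>K\<close>, let it
  always resample.

  As \<open>\<delta>\<close> tends to \<open>0\<close> the resampling disappears, so the transition probabilities at a point \<open>x\<close> of
  \<open>K\<close> converge to the Dirac measure at \<open>F x\<close>. For fixed \<open>\<delta>\<close>, one step of the chain
  ends in \<open>K\<close> almost surely, because \<open>F\<close> maps \<open>K\<close> to itself, and its law dominates \<open>p\<close> times \<open>\<nu>\<close>,
  whatever the starting point. Averaging over a stationary measure \<open>\<alpha>\<close> transfers both properties to \<open>\<alpha>\<close>: it is carried by the closed
  set \<open>K\<close>, and it charges every open set that \<open>\<nu>\<close> charges. Hence the support of \<open>\<alpha>\<close> is exactly \<open>K\<close>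
  (lemma \<open>support_stationary_resampling_kernel\<close>), at Hausdorff distance \<open>0\<close>.

  Measurability of the kernel comes down to that of \<open>F\<close> on \<open>K\<close>, where \<open>F\<close> is continuous because a
  continuous injection of a compact space into a Hausdorff space has a continuous inverse.
\<close>

section \<open>Supports of measures\<close>

text \<open>The complement of the support is a union of open null sets; by the Lindelof property countably
  many of them suffice.\<close>
lemma emeasure_compl_measure_support:
  fixes \<mu> :: "'a::second_countable_topology measure"
  assumes "sets \<mu> = sets borel"
  shows "emeasure \<mu> (- measure_support \<mu>) = 0"
proof -
  define \<U> where "\<U> = {U. open U \<and> emeasure \<mu> U = 0}"
  obtain \<C> where \<C>: "\<C> \<subseteq> \<U>" "countable \<C>" "\<Union>\<C> = \<Union>\<U>"
    using Lindelof[of \<U>] by (auto simp: \<U>_def)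
  have "- measure_support \<mu> = \<Union>\<C>"
    unfolding \<C>(3) by (auto simp: measure_support_def \<U>_def)
  moreover have "\<Union>\<C> \<in> null_sets \<mu>"
    using \<C>(1) assms by (intro null_sets_UN'[of \<C> "\<lambda>U. U", simplified] \<C>(2)) (auto simp: \<U>_def intro!: null_setsI)
  ultimately show ?thesis
    by auto
qed

lemma measure_support_subset_closed:
  assumes "closed K" "emeasure \<alpha> (- K) = 0"
  shows "measure_support \<alpha> \<subseteq> K"
  using assms by (auto simp: measure_support_def)

lemma emeasure_distr_compl_image_support:
  fixes \<mu> :: "'a::second_countable_topology measure"
    and h :: "'a \<Rightarrow> 'b::t2_space"
  assumes \<mu>: "sets \<mu> = sets borel" and h: "continuous_on UNIV h"
    and X: "compact (measure_support \<mu>)"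
  shows "emeasure (distr \<mu> borel h) (- h ` measure_support \<mu>) = 0"
proof -
  let ?K = "h ` measure_support \<mu>"
  have "compact ?K"
    using h X by (intro compact_continuous_image) (auto intro: continuous_on_subset)
  then have K: "closed ?K"
    by (rule compact_imp_closed)
  have "emeasure (distr \<mu> borel h) (- ?K) = emeasure \<mu> (h -` (- ?K))"
    using K \<mu> borel_measurable_continuous_onI[OF h]
    by (subst emeasure_distr) (auto simp: sets_eq_imp_space_eq[OF \<mu>] cong: measurable_cong_sets)
  also have "\<dots> \<le> emeasure \<mu> (- measure_support \<mu>)"
  proof (rule emeasure_mono)
    have "closed (measure_support \<mu>)"
      unfolding measure_support_def closed_def open_subopen[of "- _"] by blast
    then show "- measure_support \<mu> \<in> sets \<mu>"
      using \<mu> by auto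
  qed auto
  finally show ?thesis
    using emeasure_compl_measure_support[OF \<mu>] by simp
qed

lemma image_support_subset_support_distr:
  fixes \<mu> :: "'a::topological_space measure"
    and h :: "'a \<Rightarrow> 'b::topological_space"
  assumes \<mu>: "sets \<mu> = sets borel" and h: "continuous_on UNIV h"
  shows "h ` measure_support \<mu> \<subseteq> measure_support (distr \<mu> borel h)"
  unfolding measure_support_def
proof safe
  fix x U
  assume x: "\<forall>V. open V \<longrightarrow> x \<in> V \<longrightarrow> emeasure \<mu> V \<noteq> 0"
    and U: "open U" "h x \<in> U" and 0: "emeasure (distr \<mu> borel h) U = 0"
  have "emeasure (distr \<mu> borel h) U = emeasure \<mu> (h -` U)"
    using U \<mu> borel_measurable_continuous_onI[OF h]
    by (subst emeasure_distr) (auto simp: sets_eq_imp_space_eq[OF \<mu>] cong: measurable_cong_sets)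
  moreover have "open (h -` U)"
    using h U by (simp add: continuous_on_open_vimage)
  ultimately show False
    using x U 0 by auto
qed

section \<open>A kernel that resamples\<close>

text \<open>The coin \<open>b\<close> decides whether to use the sample \<open>y\<close> from \<open>\<nu>\<close>. Realising the mixture
  of the two moves as an image of a fixed product measure makes joint measurability
  of the update function the only thing to check.\<close>
definition resampling_kernel ::
  "real \<Rightarrow> 'a set \<Rightarrow> ('a \<Rightarrow> 'a) \<Rightarrow> 'a::topological_space measure \<Rightarrow> 'a \<Rightarrow> 'a measure" where
  "resampling_kernel p K F \<nu> x =
     distr (measure_pmf (bernoulli_pmf p) \<Otimes>\<^sub>M \<nu>) borel
       (\<lambda>(b, y). if b \<or> x \<notin> K then y else F x)"

context
  fixes \<nu> :: "'a::{second_countable_topology, t2_space} measure" and K :: "'a set" and F :: "'a \<Rightarrow> 'a"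
  assumes \<nu>: "prob_space \<nu>" "sets \<nu> = sets borel"
    and K: "closed K" and F: "continuous_on K F"
begin

lemma measurable_resampling_update:
  "(\<lambda>(x, b, y). if b \<or> x \<notin> K then y else F x)
     \<in> borel \<Otimes>\<^sub>M (measure_pmf (bernoulli_pmf p) \<Otimes>\<^sub>M \<nu>) \<rightarrow>\<^sub>M borel"
proof -
  \<comment> \<open>\<open>F\<close> need not be measurable outside \<open>K\<close>; replacing its values there by a constant changes
    nothing in the update function.\<close>
  define G where "G = (\<lambda>x. if x \<in> K then F x else undefined)"
  have G: "G \<in> borel \<rightarrow>\<^sub>M borel"
    unfolding G_def by (rule borel_measurable_continuous_on_if) (use K F in auto)
  have [measurable]: "snd \<in> measure_pmf (bernoulli_pmf p) \<Otimes>\<^sub>M \<nu> \<rightarrow>\<^sub>M borel"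
    using measurable_snd[of "measure_pmf (bernoulli_pmf p)" \<nu>] \<nu>(2)
    by (simp cong: measurable_cong_sets)
  have [measurable]: "fst \<in> measure_pmf (bernoulli_pmf p) \<Otimes>\<^sub>M \<nu> \<rightarrow>\<^sub>M count_space UNIV"
    using measurable_fst[of "measure_pmf (bernoulli_pmf p)" \<nu>]
    by (simp cong: measurable_cong_sets)
  have [measurable]: "K \<in> sets borel" "G \<in> borel \<rightarrow>\<^sub>M borel"
    using K G by auto
  have "(\<lambda>z. if fst (snd z) \<or> fst z \<notin> K then snd (snd z) else G (fst z))
     \<in> borel \<Otimes>\<^sub>M (measure_pmf (bernoulli_pmf p) \<Otimes>\<^sub>M \<nu>) \<rightarrow>\<^sub>M borel"
    by measurable
  then show ?thesis
    by (rule measurable_cong[THEN iffD1, rotated]) (auto simp: G_def split_beta)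
qed

lemma measurable_resampling_update_at:
  "(\<lambda>(b, y). if b \<or> x \<notin> K then y else F x) \<in> measure_pmf (bernoulli_pmf p) \<Otimes>\<^sub>M \<nu> \<rightarrow>\<^sub>M borel"
  using measurable_Pair2[OF measurable_resampling_update, of x p] by simp

lemma prob_space_coin_sample: "prob_space (measure_pmf (bernoulli_pmf p) \<Otimes>\<^sub>M \<nu>)"
  using \<nu>(1) by (intro prob_space_pair measure_pmf.prob_space_axioms)

lemma markov_transition_resampling_kernel: "markov_transition (resampling_kernel p K F \<nu>)"
  unfolding markov_transition_def resampling_kernel_def
proof (rule measurable_distr_prob_space2)
  show "(\<lambda>x. measure_pmf (bernoulli_pmf p) \<Otimes>\<^sub>M \<nu>) \<in> borel \<rightarrow>\<^sub>M prob_algebra (measure_pmf (bernoulli_pmf p) \<Otimes>\<^sub>M \<nu>)"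
    using prob_space_coin_sample by (intro measurable_const) (simp add: space_prob_algebra)
qed (use measurable_resampling_update in \<open>simp add: split_beta'\<close>)

text \<open>The event that the coin asks for resampling and that the sample hits \<open>A\<close> already has the
  probability on the left.\<close>
lemma resampling_kernel_ge:
  assumes p: "0 \<le> p" "p \<le> 1" and A: "A \<in> sets borel"
  shows "ennreal p * emeasure \<nu> A \<le> emeasure (resampling_kernel p K F \<nu> x) A"
proof -
  interpret prob_space \<nu> by (rule \<nu>(1))
  have "ennreal p * emeasure \<nu> A = emeasure (measure_pmf (bernoulli_pmf p) \<Otimes>\<^sub>M \<nu>) ({True} \<times> A)"
    using p A \<nu>(2) by (subst emeasure_pair_measure_Times) (auto simp: emeasure_pmf_single)
  also have "\<dots> \<le> emeasure (resampling_kernel p K F \<nu> x) A"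
    unfolding resampling_kernel_def emeasure_distr[OF measurable_resampling_update_at A]
    using measurable_sets[OF measurable_resampling_update_at A]
    by (intro emeasure_mono) (auto simp: space_pair_measure sets_eq_imp_space_eq[OF \<nu>(2)])
  finally show ?thesis .
qed

text \<open>Since \<open>F\<close> preserves \<open>K\<close>, the chain lands outside \<open>K\<close> only when the point drawn from \<open>\<nu>\<close>
  lies outside \<open>K\<close>.\<close>
lemma resampling_kernel_compl:
  assumes \<nu>K: "emeasure \<nu> (- K) = 0" and FK: "F ` K \<subseteq> K"
  shows "emeasure (resampling_kernel p K F \<nu> x) (- K) = 0"
proof -
  interpret prob_space \<nu> by (rule \<nu>(1))
  have K': "- K \<in> sets borel" using K by auto
  have "emeasure (resampling_kernel p K F \<nu> x) (- K)
      \<le> emeasure (measure_pmf (bernoulli_pmf p) \<Otimes>\<^sub>M \<nu>) (UNIV \<times> (- K))"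
    unfolding resampling_kernel_def emeasure_distr[OF measurable_resampling_update_at K']
    using K' \<nu>(2) subsetD[OF FK imageI] by (intro emeasure_mono) (auto split: if_splits)
  also have "\<dots> = 0"
    using K' \<nu>(2) \<nu>K by (subst emeasure_pair_measure_Times) auto
  finally show ?thesis by simp
qed

lemma integral_resampling_kernel:
  fixes \<phi> :: "'a \<Rightarrow> real"
  assumes p: "0 \<le> p" "p \<le> 1" and x: "x \<in> K"
    and \<phi>: "continuous_on UNIV \<phi>" "bounded (range \<phi>)"
  shows "integral\<^sup>L (resampling_kernel p K F \<nu> x) \<phi> = p * integral\<^sup>L \<nu> \<phi> + (1 - p) * \<phi> (F x)"
proof -
  interpret N: prob_space \<nu> by (rule \<nu>(1))
  interpret P: pair_prob_space "measure_pmf (bernoulli_pmf p)" \<nu> ..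
  let ?g = "\<lambda>(b, y). if b \<or> x \<notin> K then y else F x"
  obtain B where B: "\<And>y. norm (\<phi> y) \<le> B"
    using \<phi>(2) by (auto simp: bounded_iff)
  have \<phi>m: "\<phi> \<in> borel_measurable borel"
    by (rule borel_measurable_continuous_onI[OF \<phi>(1)])
  have int: "integrable (measure_pmf (bernoulli_pmf p) \<Otimes>\<^sub>M \<nu>) (\<lambda>z. \<phi> (?g z))"
    by (rule P.integrable_const_bound[of _ B])
       (use B measurable_compose[OF measurable_resampling_update_at \<phi>m] in auto)
  have "integral\<^sup>L (resampling_kernel p K F \<nu> x) \<phi>
      = (\<integral>z. \<phi> (?g z) \<partial>(measure_pmf (bernoulli_pmf p) \<Otimes>\<^sub>M \<nu>))"
    unfolding resampling_kernel_def by (rule integral_distr[OF measurable_resampling_update_at \<phi>m])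
  also have "\<dots> = (\<integral>b. (\<integral>y. \<phi> (?g (b, y)) \<partial>\<nu>) \<partial>measure_pmf (bernoulli_pmf p))"
    using P.integral_fst'[OF int] by simp
  also have "\<dots> = p * integral\<^sup>L \<nu> \<phi> + (1 - p) * \<phi> (F x)"
    using p x by (simp add: N.prob_space)
  finally show ?thesis .
qed

lemma zero_noise_limit_resampling_kernel:
  "zero_noise_limit_on K (\<lambda>\<delta>. resampling_kernel (min \<delta> 1) K F \<nu>) F"
  unfolding zero_noise_limit_on_def weak_limit_def
proof safe
  fix x and \<phi> :: "'a \<Rightarrow> real"
  assume x: "x \<in> K" and \<phi>: "continuous_on UNIV \<phi>" "bounded (range \<phi>)"
  have "((\<lambda>\<delta>. min \<delta> 1 * integral\<^sup>L \<nu> \<phi> + (1 - min \<delta> 1) * \<phi> (F x))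
      \<longlongrightarrow> min 0 1 * integral\<^sup>L \<nu> \<phi> + (1 - min 0 1) * \<phi> (F x)) (at_right 0)"
    by (intro tendsto_intros)
  moreover have "\<forall>\<^sub>F \<delta> in at_right 0. min \<delta> 1 * integral\<^sup>L \<nu> \<phi> + (1 - min \<delta> 1) * \<phi> (F x)
      = integral\<^sup>L (resampling_kernel (min \<delta> 1) K F \<nu> x) \<phi>"
    using eventually_at_right_less[of "0::real"]
    by eventually_elim (simp add: integral_resampling_kernel[OF _ _ x \<phi>])
  moreover have "integral\<^sup>L (return borel (F x)) \<phi> = \<phi> (F x)"
    by (rule integral_return) (simp_all add: borel_measurable_continuous_onI[OF \<phi>(1)])
  ultimately show "((\<lambda>\<delta>. integral\<^sup>L (resampling_kernel (min \<delta> 1) K F \<nu> x) \<phi>)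
      \<longlongrightarrow> integral\<^sup>L (return borel (F x)) \<phi>) (at_right 0)"
    by (simp add: tendsto_cong)
qed

text \<open>Both bounds on a single step hold uniformly in the starting point, hence they survive
  integration against \<open>\<alpha>\<close>.\<close>
lemma support_stationary_resampling_kernel:
  assumes \<nu>K: "emeasure \<nu> (- K) = 0" "K \<subseteq> measure_support \<nu>" and FK: "F ` K \<subseteq> K"
    and p: "0 < p" "p \<le> 1"
    and \<alpha>: "stationary (resampling_kernel p K F \<nu>) \<alpha>"
  shows "measure_support \<alpha> = K"
proof
  interpret A: prob_space \<alpha>
    using \<alpha> by (simp add: stationary_def borel_prob_measure_def)
  have step: "emeasure \<alpha> A = (\<integral>\<^sup>+ x. emeasure (resampling_kernel p K F \<nu> x) A \<partial>\<alpha>)"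
    if "A \<in> sets borel" for A
    using \<alpha> that by (simp add: stationary_def)
  have "emeasure \<alpha> (- K) = 0"
    using K by (subst step) (auto simp: resampling_kernel_compl[OF \<nu>K(1) FK])
  then show "measure_support \<alpha> \<subseteq> K"
    by (rule measure_support_subset_closed[OF K])
  have charged: "emeasure \<alpha> U \<noteq> 0" if U: "open U" "emeasure \<nu> U \<noteq> 0" for U
  proof -
    have "ennreal p * emeasure \<nu> U = (\<integral>\<^sup>+ x. ennreal p * emeasure \<nu> U \<partial>\<alpha>)"
      by (simp add: A.emeasure_space_1)
    also have "\<dots> \<le> (\<integral>\<^sup>+ x. emeasure (resampling_kernel p K F \<nu> x) U \<partial>\<alpha>)"
      using U p by (intro nn_integral_mono resampling_kernel_ge) auto
    also have "\<dots> = emeasure \<alpha> U"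
      using U by (intro step[symmetric]) auto
    finally show ?thesis
      using U(2) p by auto
  qed
  show "K \<subseteq> measure_support \<alpha>"
    using \<nu>K(2) charged by (auto simp: measure_support_def)
qed

end

section \<open>The stochastic approximation of the embedded system\<close>

lemma continuous_on_conjugate_map:
  fixes h :: "'a::topological_space \<Rightarrow> 'b::t2_space"
  assumes f: "continuous_on UNIV f" and h: "continuous_on UNIV h" "inj h" and X: "compact X"
  shows "continuous_on (h ` X) (conjugate_map h f X)"
proof -
  have "continuous_on (h ` X) (inv_into X h)"
    using h X by (intro continuous_on_inv)
      (auto intro: continuous_on_subset inv_into_f_f inj_on_subset)
  then have "continuous_on (h ` X) (\<lambda>y. h (f (inv_into X h y)))"
    by (intro continuous_on_compose2[OF h(1)] continuous_on_compose2[OF f]) auto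
  then show ?thesis
    by (simp add: conjugate_map_def comp_def)
qed

lemma hausdorff_distance_self: "hausdorff_distance A A = 0"
proof -
  have "(INF b\<in>A. ennreal (dist a b)) = 0" "(INF b\<in>A. ennreal (dist b a)) = 0" if "a \<in> A" for a
    using that INF_lower[of a A "\<lambda>b. ennreal (dist a b)"]
      INF_lower[of a A "\<lambda>b. ennreal (dist b a)"] by auto
  then show ?thesis
    by (cases "A = {}") (simp_all add: hausdorff_distance_def bot_ennreal cong: SUP_cong)
qed

theorem corollary1:
  fixes f :: "'m::{second_countable_topology, t2_space} \<Rightarrow> 'm"
    and \<mu> :: "'m measure"
    and h :: "'m \<Rightarrow> real ^ 'd"
    and x\<^sub>0 :: 'm
    and m :: nat
    and X :: "'m set"
    and F :: "real ^ 'd \<Rightarrow> real ^ 'd"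
  assumes "topological_manifold m (euclidean :: 'm topology)"
    and "continuous_on UNIV f"
    and "borel_prob_measure \<mu>"
    and "invariant_measure f \<mu>"
    and "ergodic_measure f \<mu>"
    and "X = measure_support \<mu>"
    and "compact X"
    and "continuous_on UNIV h"
    and "inj h"
    and "in_basin f \<mu> x\<^sub>0"
    and "F = conjugate_map h f X"
  shows "\<exists>Q :: real \<Rightarrow> real ^ 'd \<Rightarrow> (real ^ 'd) measure.
           (\<forall>\<delta>>0. markov_transition (Q \<delta>)) \<and>
           zero_noise_limit_on (h ` X) Q F \<and>
           (\<forall>\<delta>>0. \<forall>\<alpha>. stationary (Q \<delta>) \<alpha> \<longrightarrow>
              hausdorff_distance (measure_support \<alpha>) (h ` X) \<le> ennreal \<delta>)"
proof -
  note f = assms(2) and h = assms(8)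
  let ?K = "h ` X" and ?\<nu> = "distr \<mu> borel h"
  let ?Q = "\<lambda>\<delta>. resampling_kernel (min \<delta> 1) ?K F ?\<nu>"
  have \<mu>: "prob_space \<mu>" "sets \<mu> = sets borel"
    using assms(3) by (auto simp: borel_prob_measure_def)
  have "h \<in> \<mu> \<rightarrow>\<^sub>M borel"
    using borel_measurable_continuous_onI[OF h] \<mu>(2) by (simp cong: measurable_cong_sets)
  then have \<nu>: "prob_space ?\<nu>" "sets ?\<nu> = sets borel"
    by (auto intro: prob_space.prob_space_distr[OF \<mu>(1)])
  have "compact ?K"
    using h assms(7) by (intro compact_continuous_image) (auto intro: continuous_on_subset)
  then have K: "closed ?K"
    by (rule compact_imp_closed)
  have F: "continuous_on ?K F"
    unfolding assms(11) by (rule continuous_on_conjugate_map[OF f h assms(9,7)])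
  have FK: "F ` ?K \<subseteq> ?K"
    using conjugate_map_support_into[OF f assms(4), of h] unfolding assms(6,11) by auto
  have \<nu>K: "emeasure ?\<nu> (- ?K) = 0" "?K \<subseteq> measure_support ?\<nu>"
    using emeasure_distr_compl_image_support[OF \<mu>(2) h] assms(7)
      image_support_subset_support_distr[OF \<mu>(2) h] by (auto simp: assms(6))
  show ?thesis
  proof (intro exI[of _ ?Q] conjI allI impI)
    fix \<delta> :: real and \<alpha> assume "\<delta> > 0" "stationary (?Q \<delta>) \<alpha>"
    then have "measure_support \<alpha> = ?K"
      by (intro support_stationary_resampling_kernel[OF \<nu> K F \<nu>K FK]) auto
    then show "hausdorff_distance (measure_support \<alpha>) ?K \<le> ennreal \<delta>"
      by (simp add: hausdorff_distance_self)
  qed (rule markov_transition_resampling_kernel[OF \<nu> K F]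
       zero_noise_limit_resampling_kernel[OF \<nu> K F])+
qed

end
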